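(* Let $(\phi(\tau),\ \tau\in\mathcal{T}_0^p)$ be an admissible family, with value family $V_p$ and strict value family $V_p^+$. Let $S\in\mathcal{T}_0^p$ and let $A\in\mathcal{F}_{S^-}$. Then: 1. $V^A(\tau)=\mathbf{1}_A V_p(\tau)$ a.s. for all $\tau\in\mathcal{T}_S^p$. 2. $V^{A+}(\tau)=\mathbf{1}_A V_p^+(\tau)$ a.s. for all $\tau\in\mathcal{T}_{S^+}^p$.
   Context: Fix $T\in(0,\infty)$ and a filtered probability space $(\Omega,\mathbb{F}=(\mathcal{F}_t)_{t\in[0,T]},P)$ whose filtration satisfies the usual conditions (right-continuity and completeness) and is not quasi-left-continuous; $\mathcal{F}_0$ contains only sets of probability $0$ or $1$. For a stopping time $S$, $\mathcal{F}_{S^-}$ is the usual $\sigma$-field of events strictly before $S$ (with $\mathcal{F}_{0^-}=\mathcal{F}_0$). $\mathcal{T}_0^p$ is the set of predictable stopping times with values in $[0,T]$. For $S\in\mathcal{T}_0^p$, $\mathcal{T}_S^p$ is the set of $\tau\in\mathcal{T}_0^p$ with $\tau\ge S$ a.s., and $\mathcal{T}_{S^+}^p$ is the set of $\tau\in\mathcal{T}_0^p$ with $\tau>S$ a.s. on $\{S<T\}$ and $\tau=T$ a.s. on $\{S=T\}$. An admissible family is a family $(\phi(\tau),\ \tau\in\mathcal{T}_0^p)$ such that (1) each $\phi(\tau)$ is an $\mathcal{F}_{\tau^-}$-measurable $[0,\infty]$-valued random variable; (2) for all $\tau,\tau'\in\mathcal{T}_0^p$, $\phi(\tau)=\phi(\tau')$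 a.s. on $\{\tau=\tau'\}$. For $S\in\mathcal{T}_0^p$ put $V_p(S):=\operatorname{ess\,sup}_{\tau\in\mathcal{T}_S^p}E[\phi(\tau)|\mathcal{F}_{S^-}]$ and $V_p^+(S):=\operatorname{ess\,sup}_{\tau\in\mathcal{T}_{S^+}^p}E[\phi(\tau)|\mathcal{F}_{S^-}]$. For $A\in\mathcal{F}_{S^-}$ put $V^A(\tau):=\operatorname{ess\,sup}_{\theta\in\mathcal{T}_\tau^p}E[\phi(\theta)\mathbf{1}_A|\mathcal{F}_{\tau^-}]$ for $\tau\in\mathcal{T}_S^p$, and $V^{A+}(\tau):=\operatorname{ess\,sup}_{\theta\in\mathcal{T}_{\tau^+}^p}E[\phi(\theta)\mathbf{1}_A|\mathcal{F}_{\tau^-}]$ for $\tau\in\mathcal{T}_{S^+}^p$. Convention: $0\cdot\infty=0$. *)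

theory Defs
  imports "HOL-Probability.Probability"
begin

section \<open>Essential suprema of families of random variables\<close>

text \<open>The library's \<open>esssup\<close> is the essential supremum of a single function. Here we need the
  essential supremum of a (possibly uncountable) family of random variables: the almost surely
  smallest random variable that dominates each member almost surely.\<close>

definition is_ess_sup :: "'a measure \<Rightarrow> ('a \<Rightarrow> ennreal) set \<Rightarrow> ('a \<Rightarrow> ennreal) \<Rightarrow> bool" where
  "is_ess_sup M \<X> X \<longleftrightarrow>
     X \<in> borel_measurable M \<and>
     (\<forall>Y\<in>\<X>. AE \<omega> in M. Y \<omega> \<le> X \<omega>) \<and>
     (\<forall>Z\<in>borel_measurable M. (\<forall>Y\<in>\<X>. AE \<omega> in M. Y \<omega> \<le> Z \<omega>) \<longrightarrow> (AE \<omega> in M. X \<omega> \<le> Z \<omega>))"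

definition ess_sup :: "'a measure \<Rightarrow> ('a \<Rightarrow> ennreal) set \<Rightarrow> 'a \<Rightarrow> ennreal" where
  "ess_sup M \<X> = (SOME X. is_ess_sup M \<X> X)"

lemma is_ess_sup_unique:
  assumes "is_ess_sup M \<X> X" "is_ess_sup M \<X> Y"
  shows "AE \<omega> in M. X \<omega> = Y \<omega>"
proof -
  have "AE \<omega> in M. X \<omega> \<le> Y \<omega>" "AE \<omega> in M. Y \<omega> \<le> X \<omega>"
    using assms unfolding is_ess_sup_def by blast+
  then show ?thesis by eventually_elim simp
qed

lemma ennreal_inverse_le_iff: "inverse y \<le> inverse (x::ennreal) \<longleftrightarrow> x \<le> y"
proof (cases "x = 0 \<or> y = 0")
  case False
  then show ?thesis
    by (cases x; cases y) (auto simp: inverse_ennreal top_unique less_le)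
qed (auto simp: top_unique)

lemma is_ess_sup_ess_sup:
  assumes "prob_space M" and \<X>: "\<X> \<subseteq> borel_measurable M"
  shows "is_ess_sup M \<X> (ess_sup M \<X>)"
proof -
  interpret prob_space M by fact
  define \<C> where "\<C> = {C. C \<subseteq> \<X> \<and> countable C}"
  define s where "s C \<omega> = (SUP Y\<in>C. Y \<omega>)" for C :: "('a \<Rightarrow> ennreal) set" and \<omega>
  define I where "I C = (\<integral>\<^sup>+\<omega>. inverse (1 + s C \<omega>) \<partial>M)" for C
  have meas: "s C \<in> borel_measurable M" if "C \<in> \<C>" for C
    unfolding s_def using that \<X> by (intro borel_measurable_SUP) (auto simp: \<C>_def)
  have anti: "I D \<le> I C" if "C \<subseteq> D" for C D
    unfolding I_def s_def
    by (intro nn_integral_mono ennreal_inverse_le_iff[THEN iffD2] add_left_mono SUP_subset_mono that order_refl)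
  have "\<C> \<noteq> {}" by (auto simp: \<C>_def)
  then obtain u where u: "range u \<subseteq> I ` \<C>" "u \<longlonglongrightarrow> Inf (I ` \<C>)"
    using Inf_as_limit[of "I ` \<C>"] by (auto simp: image_subset_iff)
  then have "\<forall>n. \<exists>C\<in>\<C>. u n = I C" by auto
  then obtain C where C: "\<And>n. C n \<in> \<C>" "\<And>n. u n = I (C n)" by metis
  define D where "D = (\<Union>n. C n)"
  have D: "D \<in> \<C>" using C(1) unfolding D_def \<C>_def by (auto intro!: countable_UN)
  have "I D \<le> Inf (I ` \<C>)"
    using u(2) by (rule LIMSEQ_le_const) (auto simp: C(2) D_def intro!: anti)
  then have opt: "I D \<le> I E" if "E \<in> \<C>" for E
    using that by (auto intro: order_trans Inf_lower)
  have upper: "AE \<omega> in M. Y \<omega> \<le> s D \<omega>" if Y: "Y \<in> \<X>" for Y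
  proof -
    let ?E = "insert Y D"
    have E: "?E \<in> \<C>" using D Y by (auto simp: \<C>_def)
    have le: "inverse (1 + s ?E \<omega>) \<le> inverse (1 + s D \<omega>)" for \<omega>
      unfolding s_def by (intro ennreal_inverse_le_iff[THEN iffD2] add_left_mono SUP_subset_mono) auto
    have le1: "inverse (1 + s ?E \<omega>) \<le> 1" for \<omega>
      using ennreal_inverse_le_iff[where x=1 and y="1 + s ?E \<omega>"] by simp
    have "I ?E \<le> (\<integral>\<^sup>+\<omega>. 1 \<partial>M)" unfolding I_def by (intro nn_integral_mono le1)
    then have fin: "I ?E \<noteq> \<infinity>" by (auto simp: emeasure_space_1 top_unique)
    have m [measurable]: "s ?E \<in> borel_measurable M" "s D \<in> borel_measurable M"
      using meas E D by auto
    have "(\<integral>\<^sup>+\<omega>. inverse (1 + s D \<omega>) - inverse (1 + s ?E \<omega>) \<partial>M) = I D - I ?E"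
      unfolding I_def using fin le by (intro nn_integral_diff) (auto simp: I_def)
    also have "\<dots> = 0" using opt[OF E] by (rule diff_eq_0_ennreal[rotated]) (use opt[OF E] fin in \<open>auto simp: less_top top_unique\<close>)
    finally have "AE \<omega> in M. inverse (1 + s D \<omega>) - inverse (1 + s ?E \<omega>) = 0"
      by (subst (asm) nn_integral_0_iff_AE) auto
    then show ?thesis
    proof eventually_elim
      case (elim \<omega>)
      then have "inverse (1 + s D \<omega>) \<le> inverse (1 + s ?E \<omega>)"
        by (simp add: diff_eq_0_iff_ennreal)
      then have "1 + s ?E \<omega> \<le> 1 + s D \<omega>"
        by (simp only: ennreal_inverse_le_iff)
      then have "s ?E \<omega> \<le> s D \<omega>" by (simp add: ennreal_add_left_cancel_le)
      then show ?case unfolding s_def by (auto simp: SUP_insert)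
    qed
  qed
  have "is_ess_sup M \<X> (s D)"
    unfolding is_ess_sup_def
  proof (intro conjI ballI impI)
    show "s D \<in> borel_measurable M" using meas D .
    show "AE \<omega> in M. Y \<omega> \<le> s D \<omega>" if "Y \<in> \<X>" for Y using upper[OF that] .
    show "AE \<omega> in M. s D \<omega> \<le> Z \<omega>" if "\<forall>Y\<in>\<X>. AE \<omega> in M. Y \<omega> \<le> Z \<omega>" for Z
    proof -
      have "AE \<omega> in M. \<forall>Y\<in>D. Y \<omega> \<le> Z \<omega>"
        using that D by (subst AE_ball_countable) (auto simp: \<C>_def)
      then show ?thesis by eventually_elim (auto simp: s_def intro!: SUP_least)
    qed
  qed
  then show ?thesis unfolding ess_sup_def by (rule someI[of "is_ess_sup M \<X>"])
qed

section \<open>Filtered probability spaces on a finite time interval\<close>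

text \<open>The filtration is a family \<open>F t\<close> of sub-\<open>\<sigma>\<close>-algebras of \<open>M\<close>, of which only the members with
  \<open>0 \<le> t \<le> T\<close> matter. The library's \<open>filtration\<close> and \<open>stopping_time\<close> have a whole type as index
  set, hence the relativised versions below.\<close>

definition stopping_time_on :: "'a measure \<Rightarrow> (real \<Rightarrow> 'a measure) \<Rightarrow> real \<Rightarrow> ('a \<Rightarrow> real) \<Rightarrow> bool" where
  "stopping_time_on M F T \<tau> \<longleftrightarrow>
     (\<forall>\<omega>\<in>space M. \<tau> \<omega> \<in> {0..T}) \<and> (\<forall>t\<in>{0..T}. Measurable.pred (F t) (\<lambda>\<omega>. \<tau> \<omega> \<le> t))"

text \<open>Predictability is defined by an announcing sequence; the time \<open>0\<close> needs no announcement.\<close>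

definition predictable_times :: "'a measure \<Rightarrow> (real \<Rightarrow> 'a measure) \<Rightarrow> real \<Rightarrow> ('a \<Rightarrow> real) set" where
  "predictable_times M F T = {\<tau>. stopping_time_on M F T \<tau> \<and>
     (\<exists>\<sigma>. (\<forall>n. stopping_time_on M F T (\<sigma> n)) \<and>
          (AE \<omega> in M. incseq (\<lambda>n. \<sigma> n \<omega>) \<and> (\<lambda>n. \<sigma> n \<omega>) \<longlonglongrightarrow> \<tau> \<omega> \<and>
                      (\<tau> \<omega> > 0 \<longrightarrow> (\<forall>n. \<sigma> n \<omega> < \<tau> \<omega>))))}"

definition strict_past :: "'a measure \<Rightarrow> (real \<Rightarrow> 'a measure) \<Rightarrow> real \<Rightarrow> ('a \<Rightarrow> real) \<Rightarrow> 'a measure" where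
  "strict_past M F T \<tau> =
     sigma (space M) (sets (F 0) \<union> {B \<inter> {\<omega>\<in>space M. t < \<tau> \<omega>} | B t. t \<in> {0..T} \<and> B \<in> sets (F t)})"

definition past_sets :: "'a measure \<Rightarrow> (real \<Rightarrow> 'a measure) \<Rightarrow> real \<Rightarrow> ('a \<Rightarrow> real) \<Rightarrow> 'a set set" where
  "past_sets M F T \<tau> = {B \<in> sets M. \<forall>t\<in>{0..T}. {\<omega>\<in>B. \<tau> \<omega> \<le> t} \<in> sets (F t)}"

definition quasi_left_continuous :: "'a measure \<Rightarrow> (real \<Rightarrow> 'a measure) \<Rightarrow> real \<Rightarrow> bool" where
  "quasi_left_continuous M F T \<longleftrightarrow>
     (\<forall>\<tau>\<in>predictable_times M F T. sets (strict_past M F T \<tau>) = past_sets M F T \<tau>)"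

locale filtered_prob_space = prob_space M for M :: "'a measure" +
  fixes F :: "real \<Rightarrow> 'a measure" and T :: real
  assumes T_pos: "0 < T"
    and subalg: "t \<in> {0..T} \<Longrightarrow> subalgebra M (F t)"
    and mono: "s \<in> {0..T} \<Longrightarrow> t \<in> {0..T} \<Longrightarrow> s \<le> t \<Longrightarrow> sets (F s) \<subseteq> sets (F t)"
    and right_continuous: "t \<in> {0..<T} \<Longrightarrow> sets (F t) = (\<Inter>s\<in>{t<..T}. sets (F s))"
    and complete: "N \<in> null_sets M \<Longrightarrow> B \<subseteq> N \<Longrightarrow> B \<in> sets (F 0)"
    and initial_trivial: "B \<in> sets (F 0) \<Longrightarrow> prob B = 0 \<or> prob B = 1"
    and not_quasi_left_continuous: "\<not> quasi_left_continuous M F T"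

section \<open>Admissible families and value families\<close>

definition times_from :: "'a measure \<Rightarrow> (real \<Rightarrow> 'a measure) \<Rightarrow> real \<Rightarrow> ('a \<Rightarrow> real) \<Rightarrow> ('a \<Rightarrow> real) set" where
  "times_from M F T S = {\<tau> \<in> predictable_times M F T. AE \<omega> in M. S \<omega> \<le> \<tau> \<omega>}"

definition times_after :: "'a measure \<Rightarrow> (real \<Rightarrow> 'a measure) \<Rightarrow> real \<Rightarrow> ('a \<Rightarrow> real) \<Rightarrow> ('a \<Rightarrow> real) set" where
  "times_after M F T S = {\<tau> \<in> predictable_times M F T.
     AE \<omega> in M. (S \<omega> < T \<longrightarrow> S \<omega> < \<tau> \<omega>) \<and> (S \<omega> = T \<longrightarrow> \<tau> \<omega> = T)}"

definition admissible_family ::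
  "'a measure \<Rightarrow> (real \<Rightarrow> 'a measure) \<Rightarrow> real \<Rightarrow> (('a \<Rightarrow> real) \<Rightarrow> 'a \<Rightarrow> ennreal) \<Rightarrow> bool" where
  "admissible_family M F T \<phi> \<longleftrightarrow>
     (\<forall>\<tau>\<in>predictable_times M F T. \<phi> \<tau> \<in> borel_measurable (strict_past M F T \<tau>)) \<and>
     (\<forall>\<tau>\<in>predictable_times M F T. \<forall>\<tau>'\<in>predictable_times M F T.
        AE \<omega> in M. \<tau> \<omega> = \<tau>' \<omega> \<longrightarrow> \<phi> \<tau> \<omega> = \<phi> \<tau>' \<omega>)"

definition value_family ::
  "'a measure \<Rightarrow> (real \<Rightarrow> 'a measure) \<Rightarrow> real \<Rightarrow> (('a \<Rightarrow> real) \<Rightarrow> 'a \<Rightarrow> ennreal) \<Rightarrow> ('a \<Rightarrow> real) \<Rightarrow> 'a \<Rightarrow> ennreal" where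
  "value_family M F T \<phi> S =
     ess_sup M ((\<lambda>\<tau>. nn_cond_exp M (strict_past M F T S) (\<phi> \<tau>)) ` times_from M F T S)"

definition strict_value_family ::
  "'a measure \<Rightarrow> (real \<Rightarrow> 'a measure) \<Rightarrow> real \<Rightarrow> (('a \<Rightarrow> real) \<Rightarrow> 'a \<Rightarrow> ennreal) \<Rightarrow> ('a \<Rightarrow> real) \<Rightarrow> 'a \<Rightarrow> ennreal" where
  "strict_value_family M F T \<phi> S =
     ess_sup M ((\<lambda>\<tau>. nn_cond_exp M (strict_past M F T S) (\<phi> \<tau>)) ` times_after M F T S)"

text \<open>In \<open>ennreal\<close> we have \<open>\<infinity> * 0 = 0\<close>, as required for the products with indicators.\<close>

definition value_family_on ::
  "'a measure \<Rightarrow> (real \<Rightarrow> 'a measure) \<Rightarrow> real \<Rightarrow> (('a \<Rightarrow> real) \<Rightarrow> 'a \<Rightarrow> ennreal) \<Rightarrow> 'a set \<Rightarrow> ('a \<Rightarrow> real) \<Rightarrow> 'a \<Rightarrow> ennreal" where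
  "value_family_on M F T \<phi> A \<tau> =
     ess_sup M ((\<lambda>\<theta>. nn_cond_exp M (strict_past M F T \<tau>) (\<lambda>\<omega>. \<phi> \<theta> \<omega> * indicator A \<omega>)) ` times_from M F T \<tau>)"

definition strict_value_family_on ::
  "'a measure \<Rightarrow> (real \<Rightarrow> 'a measure) \<Rightarrow> real \<Rightarrow> (('a \<Rightarrow> real) \<Rightarrow> 'a \<Rightarrow> ennreal) \<Rightarrow> 'a set \<Rightarrow> ('a \<Rightarrow> real) \<Rightarrow> 'a \<Rightarrow> ennreal" where
  "strict_value_family_on M F T \<phi> A \<tau> =
     ess_sup M ((\<lambda>\<theta>. nn_cond_exp M (strict_past M F T \<tau>) (\<lambda>\<omega>. \<phi> \<theta> \<omega> * indicator A \<omega>)) ` times_after M F T \<tau>)"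

end

theory Submission
  imports Defs
begin

text \<open>Multiplying by \<open>1\<^sub>A\<close> commutes with every operation involved once \<open>A\<close> belongs to the
  \<open>\<sigma>\<close>-algebra on which one conditions. For \<open>S \<le> \<tau>\<close> almost surely, \<open>A\<close> does lie in the strict past
  of \<open>\<tau>\<close>, because completeness of the filtration makes the strict past monotone in the time even
  when the times are only compared almost surely (lemma \<open>strict_past_mono_AE\<close>). Hence \<open>1\<^sub>A\<close> can be
  pulled out of each conditional expectation, and then out of the essential supremum
  (lemma \<open>is_ess_sup_indicator_mult\<close>). This works for conditional expectations indexed by an
  arbitrary set (lemma \<open>ess_sup_nn_cond_exp_indicator\<close>), so the value family and the strict
  value family are two instances of one statement.\<close>

text \<open>The point is minimality: if \<open>Z\<close> dominates every \<open>1\<^sub>A X\<^sub>i\<close>, then the variable equal to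
  \<open>Z\<close> on \<open>A\<close> and to \<open>\<infinity>\<close> off \<open>A\<close> dominates every \<open>X\<^sub>i\<close>.\<close>

lemma is_ess_sup_indicator_mult:
  assumes V: "is_ess_sup M (X ` I) V"
    and A [measurable]: "A \<in> sets M"
    and Y: "\<And>i. i \<in> I \<Longrightarrow> AE \<omega> in M. Y i \<omega> = indicator A \<omega> * X i \<omega>"
  shows "is_ess_sup M (Y ` I) (\<lambda>\<omega>. indicator A \<omega> * V \<omega>)"
proof -
  have [measurable]: "V \<in> borel_measurable M"
    and upper: "\<And>i. i \<in> I \<Longrightarrow> AE \<omega> in M. X i \<omega> \<le> V \<omega>"
    and least: "\<And>Z. Z \<in> borel_measurable M \<Longrightarrow> (\<And>i. i \<in> I \<Longrightarrow> AE \<omega> in M. X i \<omega> \<le> Z \<omega>)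
      \<Longrightarrow> AE \<omega> in M. V \<omega> \<le> Z \<omega>"
    using V by (auto simp: is_ess_sup_def)
  have "AE \<omega> in M. Y i \<omega> \<le> indicator A \<omega> * V \<omega>" if "i \<in> I" for i
    using upper[OF that] Y[OF that] by eventually_elim (auto intro: mult_left_mono)
  moreover have "AE \<omega> in M. indicator A \<omega> * V \<omega> \<le> Z \<omega>"
    if [measurable]: "Z \<in> borel_measurable M" and Z: "\<And>i. i \<in> I \<Longrightarrow> AE \<omega> in M. Y i \<omega> \<le> Z \<omega>" for Z
  proof -
    have "AE \<omega> in M. X i \<omega> \<le> (if \<omega> \<in> A then Z \<omega> else \<infinity>)" if "i \<in> I" for i
      using Z[OF that] Y[OF that] by eventually_elim auto
    then have "AE \<omega> in M. V \<omega> \<le> (if \<omega> \<in> A then Z \<omega> else \<infinity>)"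
      by (intro least) measurable
    then show ?thesis by eventually_elim (auto split: if_splits)
  qed
  ultimately show ?thesis by (auto simp: is_ess_sup_def)
qed

context filtered_prob_space
begin

lemma stopping_time_on_greater_sets:
  assumes "stopping_time_on M F T \<tau>" "t \<in> {0..T}"
  shows "{\<omega> \<in> space M. t < \<tau> \<omega>} \<in> sets (F t)"
proof -
  have "space (F t) = space M" using subalg[OF assms(2)] by (simp add: subalgebra_def)
  moreover have [measurable]: "Measurable.pred (F t) (\<lambda>\<omega>. \<tau> \<omega> \<le> t)"
    using assms by (auto simp: stopping_time_on_def)
  have "{\<omega> \<in> space (F t). \<not> \<tau> \<omega> \<le> t} \<in> sets (F t)" by measurable
  ultimately show ?thesis by (simp add: not_le)
qed

lemma strict_past_generator_subset:
  assumes "stopping_time_on M F T \<tau>"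
  shows "sets (F 0) \<union> {B \<inter> {\<omega>\<in>space M. t < \<tau> \<omega>} | B t. t \<in> {0..T} \<and> B \<in> sets (F t)} \<subseteq> sets M"
proof -
  have "sets (F t) \<subseteq> sets M" if "t \<in> {0..T}" for t
    using subalg[OF that] by (simp add: subalgebra_def)
  moreover have "(0::real) \<in> {0..T}" using T_pos by simp
  ultimately show ?thesis
    using stopping_time_on_greater_sets[OF assms] by blast
qed

lemma sets_strict_past:
  assumes "stopping_time_on M F T \<tau>"
  shows "sets (strict_past M F T \<tau>) = sigma_sets (space M)
    (sets (F 0) \<union> {B \<inter> {\<omega>\<in>space M. t < \<tau> \<omega>} | B t. t \<in> {0..T} \<and> B \<in> sets (F t)})"
  unfolding strict_past_def
  using order_trans[OF strict_past_generator_subset[OF assms] sets.space_closed]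
  by (rule sets_measure_of)

lemma subalgebra_strict_past:
  assumes "stopping_time_on M F T \<tau>"
  shows "subalgebra M (strict_past M F T \<tau>)"
  using sets.sigma_sets_subset[OF strict_past_generator_subset[OF assms]]
  unfolding subalgebra_def sets_strict_past[OF assms]
  by (simp add: strict_past_def space_measure_of_conv)

text \<open>A generator \<open>B \<inter> {t < \<sigma>}\<close> of the strict past of \<open>\<sigma>\<close> is, with \<open>B \<inter> {t < \<sigma>} \<in> F t\<close> in the
  role of \<open>B\<close>, a generator \<open>(B \<inter> {t < \<sigma>}) \<inter> {t < \<tau>}\<close> of the strict past of \<open>\<tau>\<close> up to a subset of
  the null set where \<open>\<tau> < \<sigma>\<close>, and by completeness such subsets are already in \<open>F 0\<close>.\<close>

lemma strict_past_mono_AE: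
  assumes \<sigma>: "stopping_time_on M F T \<sigma>" and \<tau>: "stopping_time_on M F T \<tau>"
    and le: "AE \<omega> in M. \<sigma> \<omega> \<le> \<tau> \<omega>"
  shows "sets (strict_past M F T \<sigma>) \<subseteq> sets (strict_past M F T \<tau>)"
proof -
  let ?P = "strict_past M F T \<tau>"
  have F0: "sets (F 0) \<subseteq> sets ?P"
    unfolding sets_strict_past[OF \<tau>] by auto
  obtain N where N: "N \<in> null_sets M" "{\<omega> \<in> space M. \<not> \<sigma> \<omega> \<le> \<tau> \<omega>} \<subseteq> N"
    using le by (auto simp: eventually_ae_filter)
  have "B \<inter> {\<omega>\<in>space M. t < \<sigma> \<omega>} \<in> sets ?P" if t: "t \<in> {0..T}" and B: "B \<in> sets (F t)" for B t
  proof -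
    let ?C = "B \<inter> {\<omega>\<in>space M. t < \<sigma> \<omega>}"
    have "?C \<in> sets (F t)" using B stopping_time_on_greater_sets[OF \<sigma> t] by blast
    then have "?C \<inter> {\<omega>\<in>space M. t < \<tau> \<omega>} \<in> sets ?P"
      unfolding sets_strict_past[OF \<tau>] using t by (intro sigma_sets.Basic) blast
    moreover have "?C - {\<omega>\<in>space M. t < \<tau> \<omega>} \<in> sets ?P"
    proof (rule set_mp[OF F0], rule complete[OF N(1)])
      show "?C - {\<omega>\<in>space M. t < \<tau> \<omega>} \<subseteq> N" using N(2) by fastforce
    qed
    ultimately have "(?C \<inter> {\<omega>\<in>space M. t < \<tau> \<omega>}) \<union> (?C - {\<omega>\<in>space M. t < \<tau> \<omega>}) \<in> sets ?P"
      by (rule sets.Un)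
    then show ?thesis by (simp only: Int_Diff_Un)
  qed
  then have gen: "sets (F 0) \<union> {B \<inter> {\<omega>\<in>space M. t < \<sigma> \<omega>} | B t. t \<in> {0..T} \<and> B \<in> sets (F t)} \<subseteq> sets ?P"
    using F0 by blast
  have space: "space ?P = space M"
    using subalgebra_strict_past[OF \<tau>] by (simp add: subalgebra_def)
  show ?thesis
    using sets.sigma_sets_subset[OF gen] unfolding sets_strict_past[OF \<sigma>] space .
qed

text \<open>Applied below with \<open>G\<close> the strict past of \<open>\<tau>\<close>, and with \<open>\<Theta>\<close> the times from \<open>\<tau>\<close> on and then
  the times strictly after \<open>\<tau>\<close>.\<close>

lemma ess_sup_nn_cond_exp_indicator:
  assumes G: "subalgebra M G" and A: "A \<in> sets G"
    and X: "\<And>\<theta>. \<theta> \<in> \<Theta> \<Longrightarrow> X \<theta> \<in> borel_measurable M"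
  shows "AE \<omega> in M. ess_sup M ((\<lambda>\<theta>. nn_cond_exp M G (\<lambda>\<omega>. X \<theta> \<omega> * indicator A \<omega>)) ` \<Theta>) \<omega> =
    indicator A \<omega> * ess_sup M ((\<lambda>\<theta>. nn_cond_exp M G (X \<theta>)) ` \<Theta>) \<omega>"
proof -
  interpret finite_measure_subalgebra M G
    by unfold_locales (rule G)
  have pull_out: "AE \<omega> in M. nn_cond_exp M G (\<lambda>\<omega>. X \<theta> \<omega> * indicator A \<omega>) \<omega> =
      indicator A \<omega> * nn_cond_exp M G (X \<theta>) \<omega>" if "\<theta> \<in> \<Theta>" for \<theta>
  proof -
    have "indicator A \<in> borel_measurable G" using A by simp
    from nn_cond_exp_prod[OF this X[OF that]] show ?thesis
      unfolding mult.commute[of "X \<theta> _"] by eventually_elim (rule sym)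
  qed
  have "A \<in> sets M" using G A by (auto simp: subalgebra_def)
  then have "is_ess_sup M ((\<lambda>\<theta>. nn_cond_exp M G (\<lambda>\<omega>. X \<theta> \<omega> * indicator A \<omega>)) ` \<Theta>)
      (\<lambda>\<omega>. indicator A \<omega> * ess_sup M ((\<lambda>\<theta>. nn_cond_exp M G (X \<theta>)) ` \<Theta>) \<omega>)"
    using pull_out
    by (intro is_ess_sup_indicator_mult[OF is_ess_sup_ess_sup[OF prob_space_axioms]]) auto
  moreover have "is_ess_sup M ((\<lambda>\<theta>. nn_cond_exp M G (\<lambda>\<omega>. X \<theta> \<omega> * indicator A \<omega>)) ` \<Theta>)
      (ess_sup M ((\<lambda>\<theta>. nn_cond_exp M G (\<lambda>\<omega>. X \<theta> \<omega> * indicator A \<omega>)) ` \<Theta>))"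
    by (intro is_ess_sup_ess_sup prob_space_axioms) auto
  ultimately show ?thesis by (intro is_ess_sup_unique)
qed

lemma times_after_subset_times_from:
  assumes "stopping_time_on M F T S"
  shows "times_after M F T S \<subseteq> times_from M F T S"
proof -
  have "AE \<omega> in M. S \<omega> \<le> T"
    using assms by (intro AE_I2) (auto simp: stopping_time_on_def)
  then have le: "AE \<omega> in M. S \<omega> \<le> \<tau> \<omega>"
    if "AE \<omega> in M. (S \<omega> < T \<longrightarrow> S \<omega> < \<tau> \<omega>) \<and> (S \<omega> = T \<longrightarrow> \<tau> \<omega> = T)" for \<tau>
    using that by eventually_elim (force simp: less_le)
  show ?thesis
    unfolding times_after_def times_from_def using le by blast
qed

end

theorem mainTheorem5:
  fixes M :: "'a measure" and F :: "real \<Rightarrow> 'a measure" and T :: real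
    and \<phi> :: "('a \<Rightarrow> real) \<Rightarrow> 'a \<Rightarrow> ennreal" and S :: "'a \<Rightarrow> real" and A :: "'a set"
  assumes "filtered_prob_space M F T"
    and "admissible_family M F T \<phi>"
    and "S \<in> predictable_times M F T"
    and "A \<in> sets (strict_past M F T S)"
  shows "(\<forall>\<tau>\<in>times_from M F T S.
            AE \<omega> in M. value_family_on M F T \<phi> A \<tau> \<omega> = indicator A \<omega> * value_family M F T \<phi> \<tau> \<omega>) \<and>
         (\<forall>\<tau>\<in>times_after M F T S.
            AE \<omega> in M. strict_value_family_on M F T \<phi> A \<tau> \<omega> = indicator A \<omega> * strict_value_family M F T \<phi> \<tau> \<omega>)"
proof -
  interpret filtered_prob_space M F T by fact
  have stop: "stopping_time_on M F T \<tau>" if "\<tau> \<in> predictable_times M F T" for \<tau>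
    using that by (simp add: predictable_times_def)
  have \<phi>: "\<phi> \<theta> \<in> borel_measurable M" if "\<theta> \<in> predictable_times M F T" for \<theta>
    using assms(2) that subalgebra_strict_past[OF stop[OF that]]
    by (auto simp: admissible_family_def intro: measurable_from_subalg)
  have main: "AE \<omega> in M. ess_sup M ((\<lambda>\<theta>. nn_cond_exp M (strict_past M F T \<tau>) (\<lambda>\<omega>. \<phi> \<theta> \<omega> * indicator A \<omega>)) ` \<Theta>) \<omega> =
      indicator A \<omega> * ess_sup M ((\<lambda>\<theta>. nn_cond_exp M (strict_past M F T \<tau>) (\<phi> \<theta>)) ` \<Theta>) \<omega>"
    if \<tau>: "\<tau> \<in> times_from M F T S" and \<Theta>: "\<Theta> \<subseteq> predictable_times M F T" for \<tau> \<Theta>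
  proof (rule ess_sup_nn_cond_exp_indicator)
    have \<tau>': "stopping_time_on M F T \<tau>" "AE \<omega> in M. S \<omega> \<le> \<tau> \<omega>"
      using \<tau> stop by (auto simp: times_from_def)
    show "subalgebra M (strict_past M F T \<tau>)" using \<tau>'(1) by (rule subalgebra_strict_past)
    show "A \<in> sets (strict_past M F T \<tau>)"
      using strict_past_mono_AE[OF stop[OF assms(3)] \<tau>'] assms(4) by blast
    show "\<phi> \<theta> \<in> borel_measurable M" if "\<theta> \<in> \<Theta>" for \<theta> using that \<Theta> \<phi> by blast
  qed
  have pred: "times_from M F T \<tau> \<subseteq> predictable_times M F T"
      "times_after M F T \<tau> \<subseteq> predictable_times M F T" for \<tau>
    by (auto simp: times_from_def times_after_def)
  show ?thesis
    unfolding value_family_on_def value_family_def strict_value_family_on_def strict_value_family_def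
  proof (intro conjI ballI)
    fix \<tau> assume "\<tau> \<in> times_from M F T S"
    then show "AE \<omega> in M. ess_sup M ((\<lambda>\<theta>. nn_cond_exp M (strict_past M F T \<tau>) (\<lambda>\<omega>. \<phi> \<theta> \<omega> * indicator A \<omega>)) ` times_from M F T \<tau>) \<omega> =
        indicator A \<omega> * ess_sup M ((\<lambda>\<theta>. nn_cond_exp M (strict_past M F T \<tau>) (\<phi> \<theta>)) ` times_from M F T \<tau>) \<omega>"
      using pred(1) by (rule main)
  next
    fix \<tau> assume "\<tau> \<in> times_after M F T S"
    then have "\<tau> \<in> times_from M F T S"
      using times_after_subset_times_from[OF stop[OF assms(3)]] by (rule set_mp[rotated])
    then show "AE \<omega> in M. ess_sup M ((\<lambda>\<theta>. nn_cond_exp M (strict_past M F T \<tau>) (\<lambda>\<omega>. \<phi> \<theta> \<omega> * indicator A \<omega>)) ` times_after M F T \<tau>) \<omega> =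
        indicator A \<omega> * ess_sup M ((\<lambda>\<theta>. nn_cond_exp M (strict_past M F T \<tau>) (\<phi> \<theta>)) ` times_after M F T \<tau>) \<omega>"
      using pred(2) by (rule main)
  qed
qed

end
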